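(* Let $a>0$, $p>0$, $b>2$, and let $v(r)=\exp(-ar^p)$ for $r\ge0$. For $m>0$ let $r_m=(m/(ap))^{1/p}$, which is the global maximum point of $r\mapsto r^mv(r)$ on $[0,\infty)$. Put $m_n:=p(\log b)n^2$ for $n\in\mathbb{N}$. Then for each $n\in\mathbb{N}$ with $n\ge4$, $$b\le \Big(\frac{r_{m_n}}{r_{m_{n+1}}}\Big)^{m_n}\frac{v(r_{m_n})}{v(r_{m_{n+1}})}\le b^{9/2}$$ and $$b\le \Big(\frac{r_{m_{n+1}}}{r_{m_n}}\Big)^{m_{n+1}}\frac{v(r_{m_{n+1}})}{v(r_{m_n})}\le b^{4}.$$
   Context: $\log$ is the natural logarithm and $\mathbb{N}=\{1,2,3,\dots\}$. *)

theory Defs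
  imports Complex_Main
begin

definition weight :: "real \<Rightarrow> real \<Rightarrow> real \<Rightarrow> real" where
  "weight a p r = exp (- a * r powr p)"

definition max_point :: "real \<Rightarrow> real \<Rightarrow> real \<Rightarrow> real" where
  "max_point a p m = (m / (a * p)) powr (1 / p)"

definition exponent_seq :: "real \<Rightarrow> real \<Rightarrow> nat \<Rightarrow> real" where
  "exponent_seq p b n = p * ln b * (real n)\<^sup>2"

end

(*
  In the logarithmic variable s = r^p / rho_m^p, the function r^m v(r) is, up to a constant factor,
  exp ((m/p) (ln s - (s - 1))), so its maximum is the strict inequality ln s < s - 1 for s \<noteq> 1.
  The same substitution gives (rho_m / rho_k)^m v(rho_m) / v(rho_k) = exp ((m ln (m/k) - (m - k)) / p).
  For consecutive terms of m_n this is b raised to 2n + 1 - 2n^2 ln (1 + 1/n), respectively to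
  2(n+1)^2 ln (1 + 1/n) - (2n+1), and the bounds follow from x/(1+x) \<le> ln (1+x) \<le> x and x - x^2 \<le> ln (1+x).
*)
theory Submission
  imports Defs
begin

lemma max_point_pos:
  assumes "a > 0" "p > 0" "m > 0"
  shows "max_point a p m > 0"
  using assms by (simp add: max_point_def)

lemma max_point_powr:
  assumes "a > 0" "p > 0" "m > 0"
  shows "max_point a p m powr p = m / (a * p)"
  using assms by (simp add: max_point_def powr_powr)

lemma ln_max_point:
  assumes "a > 0" "p > 0" "m > 0"
  shows "ln (max_point a p m) = ln (m / (a * p)) / p"
  using assms by (simp add: max_point_def ln_powr)

lemma weight_max_point:
  assumes "a > 0" "p > 0" "m > 0"
  shows "weight a p (max_point a p m) = exp (- (m / p))"
  using assms by (simp add: weight_def max_point_powr)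

text \<open>The inequality is strict so that it gives uniqueness of the maximum point as well as
  maximality.\<close>

lemma powr_weight_less_max:
  assumes "a > 0" "p > 0" "m > 0" "r \<ge> 0" "r \<noteq> max_point a p m"
  shows "r powr m * weight a p r < max_point a p m powr m * weight a p (max_point a p m)"
\<comment> \<open>At 0 no logarithm is available, but \<open>0 powr m = 0\<close> makes the left
  side vanish while the right side is positive.\<close>
proof (cases "r = 0")
  case True
  then show ?thesis
    using assms max_point_pos[of a p m] by (simp add: weight_def)
next
  case False
  define R where "R = max_point a p m"
  define s where "s = r powr p / R powr p"
  have r: "r > 0" and R: "R > 0"
    using False assms max_point_pos[of a p m] by (auto simp: R_def)
  have s: "s > 0"
    using r R by (simp add: s_def)
  have "s \<noteq> 1"
  proof
    assume "s = 1"
    then have "r powr p = R powr p"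
      using R by (simp add: s_def)
    then have "r = R"
      using r R \<open>p > 0\<close> by (metis less_imp_le powr_less_mono2 linorder_neqE_linordered_idom less_irrefl)
    then show False
      using assms by (simp add: R_def)
  qed
  then have "ln s < s - 1"
    using s ln_le_minus_one[of s] ln_eq_minus_one[of s] by force
  \<comment> \<open>The factor \<open>m / p\<close> equals \<open>a * R powr p\<close>, so the two
    sides become the differences between \<open>r\<close> and \<open>R\<close> of
    \<open>m * ln\<close> and of \<open>a\<close> times the \<open>p\<close>-th power.\<close>
  then have "(m / p) * ln s < (m / p) * (s - 1)"
    using assms by (intro mult_strict_left_mono) auto
  moreover have "ln s = p * (ln r - ln R)"
    using r R by (simp add: s_def ln_div ln_powr algebra_simps)
  moreover have Rp: "a * R powr p = m / p"
    using assms by (simp add: R_def max_point_powr)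
  moreover have "a * r powr p = s * (m / p)"
    using R by (simp add: s_def flip: Rp)
  ultimately have "m * ln r - a * r powr p < m * ln R - a * R powr p"
    using \<open>p > 0\<close> by (simp add: algebra_simps diff_divide_distrib)
  then have "exp (m * ln r - a * r powr p) < exp (m * ln R - a * R powr p)"
    by simp
  then show ?thesis
    using r R by (simp add: weight_def powr_def mult_exp_exp flip: R_def)
qed

text \<open>Any other nonnegative point is strictly beaten by \<open>max_point a p m\<close>, which
  itself is beaten by none.\<close>

lemma is_arg_max_max_point:
  assumes "a > 0" "p > 0" "m > 0"
  shows "is_arg_max (\<lambda>r. r powr m * weight a p r) (\<lambda>r. 0 \<le> r) x \<longleftrightarrow> x = max_point a p m"
  using powr_weight_less_max[OF assms] max_point_pos[OF assms]
  unfolding is_arg_max_def by (metis less_imp_le less_asym less_irrefl)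

text \<open>The factor \<open>a * p\<close> cancels in the quotient of the maximum points, and the
  weights there are \<open>exp (- (m / p))\<close> and \<open>exp (- (k / p))\<close>, so
  \<open>a\<close> disappears. No order between \<open>m\<close> and \<open>k\<close> is fixed, so
  the formula serves both directions.\<close>

lemma max_point_ratio:
  assumes "a > 0" "p > 0" "m > 0" "k > 0"
  shows "(max_point a p m / max_point a p k) powr m *
      (weight a p (max_point a p m) / weight a p (max_point a p k)) =
    exp ((m * ln (m / k) - (m - k)) / p)"
proof -
  have pos: "max_point a p m > 0" "max_point a p k > 0"
    using assms by (simp_all add: max_point_pos)
  then have "ln (max_point a p m / max_point a p k) = ln (m / k) / p"
    using assms by (simp add: ln_div ln_max_point ln_mult field_simps)
  then have "(max_point a p m / max_point a p k) powr m = exp (m * (ln (m / k) / p))"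
    using pos by (simp add: powr_def)
  moreover have "weight a p (max_point a p m) / weight a p (max_point a p k) = exp (k / p - m / p)"
    using assms by (simp add: weight_max_point flip: exp_diff)
  ultimately show ?thesis
    using assms by (simp add: mult_exp_exp field_simps)
qed

lemma exponent_seq_pos:
  assumes "p > 0" "b > 1" "n > 0"
  shows "exponent_seq p b n > 0"
  using assms by (simp add: exponent_seq_def)

text \<open>The factor \<open>p * ln b\<close> in \<open>exponent_seq\<close> cancels the division
  by \<open>p\<close> and leaves \<open>ln b\<close> in the exponent, which turns \<open>exp\<close>
  into a power of \<open>b\<close>.\<close>

lemma consecutive_ratio_down:
  assumes "a > 0" "p > 0" "b > 1" "n > 0"
  defines "m \<equiv> exponent_seq p b n" and "k \<equiv> exponent_seq p b (n + 1)"
  shows "(max_point a p m / max_point a p k) powr m *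
      (weight a p (max_point a p m) / weight a p (max_point a p k)) =
    b powr (2 * real n + 1 - 2 * (real n)\<^sup>2 * ln (1 + 1 / real n))"
proof -
  have "m / k = (real n / (real n + 1))\<^sup>2"
    using assms by (simp add: exponent_seq_def power_divide)
  moreover have "real n / (real n + 1) = inverse (1 + 1 / real n)"
    using \<open>n > 0\<close> by (simp add: field_simps)
  moreover have "1 + 1 / real n > 0"
    by (simp add: add_pos_nonneg)
  ultimately have "ln (m / k) = - 2 * ln (1 + 1 / real n)"
    by (simp add: ln_realpow ln_inverse)
  moreover have "m > 0" "k > 0"
    using assms by (simp_all add: exponent_seq_pos)
  ultimately show ?thesis
    using assms(1-4) max_point_ratio[of a p m k]
    by (simp add: powr_def m_def k_def exponent_seq_def field_simps power2_eq_square)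
qed

lemma consecutive_ratio_up:
  assumes "a > 0" "p > 0" "b > 1" "n > 0"
  defines "m \<equiv> exponent_seq p b n" and "k \<equiv> exponent_seq p b (n + 1)"
  shows "(max_point a p k / max_point a p m) powr k *
      (weight a p (max_point a p k) / weight a p (max_point a p m)) =
    b powr (2 * (real n + 1)\<^sup>2 * ln (1 + 1 / real n) - (2 * real n + 1))"
proof -
  have "k / m = ((real n + 1) / real n)\<^sup>2"
    using assms by (simp add: exponent_seq_def power_divide add.commute)
  moreover have "(real n + 1) / real n = 1 + 1 / real n"
    using \<open>n > 0\<close> by (simp add: field_simps)
  moreover have "1 + 1 / real n > 0"
    by (simp add: add_pos_nonneg)
  ultimately have "ln (k / m) = 2 * ln (1 + 1 / real n)"
    by (simp add: ln_realpow)
  moreover have "m > 0" "k > 0"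
    using assms by (simp_all add: exponent_seq_pos)
  ultimately show ?thesis
    using assms(1-4) max_point_ratio[of a p k m]
    by (simp add: powr_def m_def k_def exponent_seq_def field_simps power2_eq_square)
qed

text \<open>These are the exponents of \<open>b\<close> in the two consecutive ratios, with a real
  \<open>x\<close> in place of \<open>n\<close>. The range \<open>x \<ge> 2\<close> enters the last
  bound through \<open>2 / x \<le> 1\<close>.\<close>

lemma exponent_bounds:
  fixes x :: real
  assumes "x \<ge> 2"
  shows "1 \<le> 2 * x + 1 - 2 * x\<^sup>2 * ln (1 + 1 / x)"
    and "2 * x + 1 - 2 * x\<^sup>2 * ln (1 + 1 / x) \<le> 3"
    and "1 \<le> 2 * (x + 1)\<^sup>2 * ln (1 + 1 / x) - (2 * x + 1)"
    and "2 * (x + 1)\<^sup>2 * ln (1 + 1 / x) - (2 * x + 1) \<le> 4"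
proof -
  have up: "ln (1 + 1 / x) \<le> 1 / x"
    using assms by (intro ln_add_one_self_le_self) auto
  have low: "1 / x - (1 / x)\<^sup>2 \<le> ln (1 + 1 / x)"
    using assms by (intro ln_one_plus_pos_lower_bound) auto
  \<comment> \<open>Applying \<open>ln y \<le> y - 1\<close> to the reciprocal turns that upper
    bound into a lower bound for \<open>ln (1 + 1 / x)\<close>.\<close>
  have "1 + 1 / x = inverse (x / (x + 1))"
    using assms by (simp add: field_simps)
  then have "ln (1 + 1 / x) = - ln (x / (x + 1))"
    using assms by (simp add: ln_inverse del: inverse_divide)
  moreover have "ln (x / (x + 1)) \<le> x / (x + 1) - 1"
    using assms by (intro ln_le_minus_one) auto
  moreover have "x / (x + 1) - 1 = - (1 / (x + 1))"
    using assms by (simp add: field_simps)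
  ultimately have low': "1 / (x + 1) \<le> ln (1 + 1 / x)"
    by linarith
  have "2 * x\<^sup>2 * ln (1 + 1 / x) \<le> 2 * x\<^sup>2 * (1 / x)"
    using up by (intro mult_left_mono) auto
  also have "\<dots> = 2 * x"
    using assms by (simp add: power2_eq_square)
  finally show "1 \<le> 2 * x + 1 - 2 * x\<^sup>2 * ln (1 + 1 / x)"
    by simp
  have "2 * x - 2 = 2 * x\<^sup>2 * (1 / x - (1 / x)\<^sup>2)"
    using assms by (simp add: field_simps power2_eq_square)
  also have "\<dots> \<le> 2 * x\<^sup>2 * ln (1 + 1 / x)"
    using low by (intro mult_left_mono) auto
  finally show "2 * x + 1 - 2 * x\<^sup>2 * ln (1 + 1 / x) \<le> 3"
    by simp
  have "2 * (x + 1) = 2 * (x + 1)\<^sup>2 * (1 / (x + 1))"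
    using assms by (simp add: power2_eq_square)
  also have "\<dots> \<le> 2 * (x + 1)\<^sup>2 * ln (1 + 1 / x)"
    using low' by (intro mult_left_mono) auto
  finally show "1 \<le> 2 * (x + 1)\<^sup>2 * ln (1 + 1 / x) - (2 * x + 1)"
    by simp
  have "2 * (x + 1)\<^sup>2 * ln (1 + 1 / x) \<le> 2 * (x + 1)\<^sup>2 * (1 / x)"
    using up by (intro mult_left_mono) auto
  also have "\<dots> = 2 * x + 4 + 2 / x"
    using assms by (simp add: field_simps power2_eq_square)
  also have "2 / x \<le> 1"
    using assms by simp
  finally show "2 * (x + 1)\<^sup>2 * ln (1 + 1 / x) - (2 * x + 1) \<le> 4"
    by simp
qed

theorem proposition3p2:
  fixes a p b :: real
  fixes v :: "real \<Rightarrow> real" and \<rho> :: "real \<Rightarrow> real" and M :: "nat \<Rightarrow> real"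
  assumes "a > 0" and "p > 0" and "b > 2"
  defines "v \<equiv> weight a p" and "\<rho> \<equiv> max_point a p" and "M \<equiv> exponent_seq p b"
  shows "(\<forall>m>0. \<forall>x. is_arg_max (\<lambda>r. r powr m * v r) (\<lambda>r. 0 \<le> r) x \<longleftrightarrow> x = \<rho> m) \<and>
    (\<forall>n::nat. n \<ge> 4 \<longrightarrow>
      b \<le> (\<rho> (M n) / \<rho> (M (n + 1))) powr M n * (v (\<rho> (M n)) / v (\<rho> (M (n + 1)))) \<and>
      (\<rho> (M n) / \<rho> (M (n + 1))) powr M n * (v (\<rho> (M n)) / v (\<rho> (M (n + 1)))) \<le> b powr (9 / 2) \<and>
      b \<le> (\<rho> (M (n + 1)) / \<rho> (M n)) powr M (n + 1) * (v (\<rho> (M (n + 1))) / v (\<rho> (M n))) \<and>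
      (\<rho> (M (n + 1)) / \<rho> (M n)) powr M (n + 1) * (v (\<rho> (M (n + 1))) / v (\<rho> (M n))) \<le> b ^ 4)"
proof (intro conjI allI impI)
  show "is_arg_max (\<lambda>r. r powr m * v r) (\<lambda>r. 0 \<le> r) x \<longleftrightarrow> x = \<rho> m" if "m > 0" for m x
    using is_arg_max_max_point[of a p m x] assms(1,2) that by (simp add: v_def \<rho>_def)
next
  fix n :: nat
  assume "n \<ge> 4"
  then have n: "n > 0" "real n \<ge> 2"
    by simp_all
  have b: "b > 1"
    using assms(3) by simp
  note down = consecutive_ratio_down[OF assms(1,2) b n(1), folded v_def \<rho>_def M_def]
    and up = consecutive_ratio_up[OF assms(1,2) b n(1), folded v_def \<rho>_def M_def]
  note bounds = exponent_bounds[OF n(2)]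
  \<comment> \<open>With all terms written as powers of \<open>b > 1\<close>, only exponents remain
    to be compared.\<close>
  have b1: "b = b powr 1" and b4: "b ^ 4 = b powr 4"
    using b by (simp_all add: powr_numeral)
  show "b \<le> (\<rho> (M n) / \<rho> (M (n + 1))) powr M n * (v (\<rho> (M n)) / v (\<rho> (M (n + 1))))"
    unfolding down by (subst b1, rule powr_mono) (use bounds b in auto)
  \<comment> \<open>The exponent is at most 3, hence below \<open>9 / 2\<close>.\<close>
  show "(\<rho> (M n) / \<rho> (M (n + 1))) powr M n * (v (\<rho> (M n)) / v (\<rho> (M (n + 1)))) \<le> b powr (9 / 2)"
    unfolding down by (rule powr_mono) (use bounds b in auto)
  show "b \<le> (\<rho> (M (n + 1)) / \<rho> (M n)) powr M (n + 1) * (v (\<rho> (M (n + 1))) / v (\<rho> (M n)))"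
    unfolding up by (subst b1, rule powr_mono) (use bounds b in auto)
  show "(\<rho> (M (n + 1)) / \<rho> (M n)) powr M (n + 1) * (v (\<rho> (M (n + 1))) / v (\<rho> (M n))) \<le> b ^ 4"
    unfolding up b4 by (rule powr_mono) (use bounds b in auto)
qed

end
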